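(* Let $\mathfrak U$ and $\mathfrak V$ be generalized models (in the narrow sense) in the same signature with universes $\beta X$ and $\beta Y$, let the interpretation of $\mathfrak U$ be pseudo-principal on functional symbols with principal submodel $\mathfrak A$ (universe $X$), so that $\widetilde{\mathfrak A}=e(\mathfrak U)$ and $\mathfrak A^*=E(\mathfrak U)$, and let $h:X\to Y$. The following are equivalent: (i) $h$ is a homomorphism of $\mathfrak A$ into $e(\mathfrak V)$; (ii) $h$ is a homomorphism of $\mathfrak A$ into $E(\mathfrak V)$; (iii) $\tilde h$ is a homomorphism of $\mathfrak U$ into $\mathfrak V$; (iv) $\tilde h$ is a homomorphism of $\widetilde{\mathfrak A}$ into $e(\mathfrak V)$; (v) $\tilde h$ is a homomorphism of $\mathfrak A^*$ into $E(\mathfrak V)$.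
   Context: $\beta Z$ is the set of ultrafilters on $Z$, $Z\subseteq\beta Z$ via principal ultrafilters, standard compact Hausdorff topology; $(\forall^{\mathfrak u}z)\varphi$ means $\{z:\varphi\}\in\mathfrak u$. For $h:X\to Y$, $\tilde h(\mathfrak u)=\{A\subseteq Y:h^{-1}(A)\in\mathfrak u\}$. For $f:Z^n\to Z$, $\tilde f(\mathfrak u_1,\dots,\mathfrak u_n)=\{A:(\forall^{\mathfrak u_1}z_1)\cdots(\forall^{\mathfrak u_n}z_n)f(z_1,\dots,z_n)\in A\}$; for $Q\subseteq Z^n$, $\tilde Q=\{(\mathfrak u_i):(\forall^{\mathfrak u_1}z_1)\cdots(\forall^{\mathfrak u_n}z_n)(z_1,\dots,z_n)\in Q\}$, $Q^*=\{(\mathfrak u_i):\forall A_i\in\mathfrak u_i\ Q\cap(A_1\times\dots\times A_n)\ne\emptyset\}$; for an ordinary model $\mathfrak A=(Z,F,\dots,R,\dots)$, $\widetilde{\mathfrak A}=(\beta Z,\tilde F,\dots,\tilde R,\dots)$, $\mathfrak A^*=(\beta Z,\tilde F,\dots,R^*,\dots)$. Homomorphisms of ordinary models are maps commuting with operations and preserving relations. A generalized model in the narrow sense with universe $\beta Z$ is an interpretation $\imath$ with $\imath(F)\in\beta(Z^{Z^n})$, $\imath(R)\in\beta\,\mathcal P(Z^n)$; it is pseudo-principal on functional symbols if for all $F$ and $a_1,\dots,a_n\in Z$ the ultrafilter $\{A:(\forall^{\imath(F)}f)f(a_1,\dots,a_n)\in A\}$ is principal. $e=E$ on $\beta(Z^{Z^n})$: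 the unique continuous extension of $f\mapsto\tilde f$ into the compact Hausdorff space of $n$-ary operations on $\beta Z$ right continuous w.r.t. $Z$ (continuous in the $i$-th argument when the first $i-1$ arguments lie in $Z$), with the topology of pointwise convergence on $Z^n$; $e$ on $\beta\,\mathcal P(Z^n)$: the same construction with relations identified with characteristic functions into discrete $\{0,1\}$; $E(\mathfrak r)=\{(\pi_1(\mathfrak q),\dots,\pi_n(\mathfrak q)):\mathfrak q\in e_1(\mathfrak r)\}$, $e_1(\mathfrak r)\subseteq\beta(Z^n)$ the $e$-construction applied to $\mathfrak r$ as an ultrafilter over unary relations on $Z^n$, $\pi_i(\mathfrak q)=\{A:\{x:x_i\in A\}\in\mathfrak q\}$. $e(\mathfrak U),E(\mathfrak U)$ are the ordinary models on $\beta Z$ obtained by applying $e$, resp. $E$, to all interpreting ultrafilters. When the interpretation of $\mathfrak U$ is pseudo-principal on functional symbols, $X$ is closed under the operations of $e(\mathfrak U)$, and the principal submodel is the submodel of $e(\mathfrak U)$ with universe $X$. A map $g:\beta X\to\beta Y$ is a homomorphism of $\mathfrak U$ into $\mathfrak V$ iff it is a homomorphism of $e(\mathfrak U)$ into $e(\mathfrak V)$. *)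

theory Defs
  imports "HOL-Analysis.Analysis" "HOL-Library.NList"
begin

section \<open>Ultrafilters on a set and ultrafilter extensions\<close>

text \<open>
  Ultrafilters are represented by the library type of filters: a set \<open>A\<close> belongs to \<open>u\<close> iff
  \<open>\<forall>\<^sub>F z in u. z \<in> A\<close>, and \<open>\<forall>\<^sub>F z in u. \<phi> z\<close> is the ultrafilter quantifier.  An ultrafilter on a
  carrier \<open>Z\<close> is one that contains \<open>Z\<close>, that is, \<open>u \<le> principal Z\<close>.  The point \<open>z\<close>
  is identified with \<open>principal {z}\<close>, and the extension of \<open>h : X \<rightarrow> Y\<close> to ultrafilters
  is \<open>filtermap h\<close>.  \<open>Z\<^sup>n\<close> is \<open>nlists n Z\<close>, and \<open>Z\<close> to the power \<open>Z\<^sup>n\<close> is \<open>nlists n Z \<rightarrow>\<^sub>E Z\<close>.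
\<close>

definition beta :: "'a set \<Rightarrow> 'a filter set" where
  "beta Z = {u. u \<noteq> bot \<and> u \<le> principal Z \<and>
     (\<forall>P. eventually P u \<or> eventually (\<lambda>z. \<not> P z) u)}"

definition beta_top :: "'a set \<Rightarrow> 'a filter topology" where
  "beta_top Z = topology_generated_by {{u \<in> beta Z. \<forall>\<^sub>F z in u. z \<in> A} | A. A \<subseteq> Z}"

primrec iter_ev :: "'a filter list \<Rightarrow> ('a list \<Rightarrow> bool) \<Rightarrow> bool" where
  "iter_ev [] P \<longleftrightarrow> P []"
| "iter_ev (u # us) P \<longleftrightarrow> (\<forall>\<^sub>F z in u. iter_ev us (\<lambda>zs. P (z # zs)))"

definition tilde_op :: "'a set \<Rightarrow> nat \<Rightarrow> ('a list \<Rightarrow> 'a) \<Rightarrow> ('a filter list \<Rightarrow> 'a filter)" where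
  "tilde_op Z n f = (\<lambda>us \<in> nlists n (beta Z). Abs_filter (\<lambda>P. iter_ev us (\<lambda>zs. P (f zs))))"

definition tilde_rel :: "'a set \<Rightarrow> nat \<Rightarrow> 'a list set \<Rightarrow> 'a filter list set" where
  "tilde_rel Z n Q = {us \<in> nlists n (beta Z). iter_ev us (\<lambda>zs. zs \<in> Q)}"

definition star_rel :: "'a set \<Rightarrow> nat \<Rightarrow> 'a list set \<Rightarrow> 'a filter list set" where
  "star_rel Z n Q = {us \<in> nlists n (beta Z).
     \<forall>As. list_all2 (\<lambda>A u. A \<subseteq> Z \<and> (\<forall>\<^sub>F z in u. z \<in> A)) As us \<longrightarrow> Q \<inter> listset As \<noteq> {}}"

lemma iter_ev_True: "iter_ev us (\<lambda>_. True)"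
  by (induction us) simp_all

lemma iter_ev_mono: "iter_ev us P \<Longrightarrow> (\<And>zs. P zs \<Longrightarrow> Q zs) \<Longrightarrow> iter_ev us Q"
  by (induction us arbitrary: P Q) (auto elim!: eventually_mono)

lemma iter_ev_conj: "iter_ev us P \<Longrightarrow> iter_ev us Q \<Longrightarrow> iter_ev us (\<lambda>zs. P zs \<and> Q zs)"
proof (induction us arbitrary: P Q)
  case (Cons u us)
  have "\<forall>\<^sub>F z in u. iter_ev us (\<lambda>zs. P (z # zs)) \<and> iter_ev us (\<lambda>zs. Q (z # zs))"
    using Cons.prems by (auto intro: eventually_conj)
  then show ?case
    by (auto elim!: eventually_mono intro: Cons.IH)
qed simp

lemma eventually_tilde_op:
  assumes "us \<in> nlists n (beta Z)"
  shows "eventually P (tilde_op Z n f us) \<longleftrightarrow> iter_ev us (\<lambda>zs. P (f zs))"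
proof -
  have "is_filter (\<lambda>P. iter_ev us (\<lambda>zs. P (f zs)))"
    by (rule is_filter.intro)
       (auto intro: iter_ev_True iter_ev_conj elim: iter_ev_mono)
  then show ?thesis
    using assms by (simp add: tilde_op_def eventually_Abs_filter)
qed


section \<open>Continuous extensions\<close>

text \<open>
  \<open>rc Z n T\<close> consists of the maps from \<open>n\<close>-tuples of ultrafilters on \<open>Z\<close> to \<open>T\<close> that are right
  continuous with respect to \<open>Z\<close>: continuous in each argument whenever all the arguments
  before it are principal.  \<open>rc_top\<close> is the topology of pointwise convergence on the tuples of
  principal ultrafilters.
\<close>

definition rc :: "'a set \<Rightarrow> nat \<Rightarrow> 'b topology \<Rightarrow> ('a filter list \<Rightarrow> 'b) set" where
  "rc Z n T = {F \<in> nlists n (beta Z) \<rightarrow>\<^sub>E topspace T.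
     \<forall>i<n. \<forall>us \<in> nlists n (beta Z). (\<forall>j<i. \<exists>z\<in>Z. us ! j = principal {z}) \<longrightarrow>
       continuous_map (beta_top Z) T (\<lambda>u. F (us[i := u]))}"

definition rc_top :: "'a set \<Rightarrow> nat \<Rightarrow> 'b topology \<Rightarrow> ('a filter list \<Rightarrow> 'b) topology" where
  "rc_top Z n T = pullback_topology (rc Z n T)
     (\<lambda>F. \<lambda>zs \<in> nlists n Z. F (map (\<lambda>z. principal {z}) zs))
     (product_topology (\<lambda>_. T) (nlists n Z))"

definition cont_ext :: "'s set \<Rightarrow> 'b topology \<Rightarrow> ('s \<Rightarrow> 'b) \<Rightarrow> 's filter \<Rightarrow> 'b" where
  "cont_ext S T \<phi> = (THE g. g \<in> extensional (beta S) \<and> continuous_map (beta_top S) T g \<and>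
     (\<forall>s\<in>S. g (principal {s}) = \<phi> s))"

definition e_op :: "'a set \<Rightarrow> nat \<Rightarrow> ('a list \<Rightarrow> 'a) filter \<Rightarrow> ('a filter list \<Rightarrow> 'a filter)" where
  "e_op Z n = cont_ext (nlists n Z \<rightarrow>\<^sub>E Z) (rc_top Z n (beta_top Z)) (tilde_op Z n)"

text \<open>
  For relations the discrete space \<open>{0,1}\<close> is \<open>bool\<close>; the extension is applied to the
  characteristic functions.
\<close>

definition e_rel :: "'a set \<Rightarrow> nat \<Rightarrow> 'a list set filter \<Rightarrow> 'a filter list set" where
  "e_rel Z n r = {us \<in> nlists n (beta Z).
     cont_ext (Pow (nlists n Z)) (rc_top Z n (discrete_topology (UNIV :: bool set)))
       (\<lambda>Q. \<lambda>us \<in> nlists n (beta Z). us \<in> tilde_rel Z n Q) r us}"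

text \<open>
  Here a subset of \<open>Z\<^sup>n\<close> is regarded as a unary relation on \<open>Z\<^sup>n\<close>, that is, as a set of
  one-element lists of elements of \<open>Z\<^sup>n\<close>.
\<close>

definition e1_rel :: "'a set \<Rightarrow> nat \<Rightarrow> 'a list set filter \<Rightarrow> 'a list filter set" where
  "e1_rel Z n r = {q. [q] \<in> e_rel (nlists n Z) 1 (filtermap (\<lambda>R. (\<lambda>x. [x]) ` R) r)}"

definition E_rel :: "'a set \<Rightarrow> nat \<Rightarrow> 'a list set filter \<Rightarrow> 'a filter list set" where
  "E_rel Z n r = {map (\<lambda>i. filtermap (\<lambda>x. x ! i) q) [0..<n] | q. q \<in> e1_rel Z n r}"


section \<open>Models\<close>

record ('f, 'r) signature =
  fsyms :: "'f set"
  rsyms :: "'r set"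
  farity :: "'f \<Rightarrow> nat"
  rarity :: "'r \<Rightarrow> nat"

record ('a, 'f, 'r) model =
  universe :: "'a set"
  opn :: "'f \<Rightarrow> 'a list \<Rightarrow> 'a"
  reln :: "'r \<Rightarrow> 'a list set"

definition homomorphism ::
    "('f, 'r) signature \<Rightarrow> ('a, 'f, 'r) model \<Rightarrow> ('b, 'f, 'r) model \<Rightarrow> ('a \<Rightarrow> 'b) \<Rightarrow> bool" where
  "homomorphism \<Sigma> A B h \<longleftrightarrow>
     h \<in> universe A \<rightarrow> universe B \<and>
     (\<forall>F \<in> fsyms \<Sigma>. \<forall>xs \<in> nlists (farity \<Sigma> F) (universe A).
        h (opn A F xs) = opn B F (map h xs)) \<and>
     (\<forall>R \<in> rsyms \<Sigma>. \<forall>xs \<in> nlists (rarity \<Sigma> R) (universe A).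
        xs \<in> reln A R \<longrightarrow> map h xs \<in> reln B R)"

definition tilde_model ::
    "('f, 'r) signature \<Rightarrow> ('a, 'f, 'r) model \<Rightarrow> ('a filter, 'f, 'r) model" where
  "tilde_model \<Sigma> A =
     \<lparr>universe = beta (universe A),
      opn = (\<lambda>F \<in> fsyms \<Sigma>. tilde_op (universe A) (farity \<Sigma> F) (opn A F)),
      reln = (\<lambda>R \<in> rsyms \<Sigma>. tilde_rel (universe A) (rarity \<Sigma> R) (reln A R))\<rparr>"

definition star_model ::
    "('f, 'r) signature \<Rightarrow> ('a, 'f, 'r) model \<Rightarrow> ('a filter, 'f, 'r) model" where
  "star_model \<Sigma> A =
     \<lparr>universe = beta (universe A),
      opn = (\<lambda>F \<in> fsyms \<Sigma>. tilde_op (universe A) (farity \<Sigma> F) (opn A F)),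
      reln = (\<lambda>R \<in> rsyms \<Sigma>. star_rel (universe A) (rarity \<Sigma> R) (reln A R))\<rparr>"

text \<open>
  The interpretation of a generalized model; its universe \<open>beta Z\<close> is kept as a separate
  argument \<open>Z\<close>.
\<close>

record ('a, 'f, 'r) interp =
  gop :: "'f \<Rightarrow> ('a list \<Rightarrow> 'a) filter"
  grel :: "'r \<Rightarrow> 'a list set filter"

definition generalized_model ::
    "('f, 'r) signature \<Rightarrow> 'a set \<Rightarrow> ('a, 'f, 'r) interp \<Rightarrow> bool" where
  "generalized_model \<Sigma> Z U \<longleftrightarrow>
     (\<forall>F \<in> fsyms \<Sigma>. gop U F \<in> beta (nlists (farity \<Sigma> F) Z \<rightarrow>\<^sub>E Z)) \<and>
     (\<forall>R \<in> rsyms \<Sigma>. grel U R \<in> beta (Pow (nlists (rarity \<Sigma> R) Z)))"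

definition pseudo_principal ::
    "('f, 'r) signature \<Rightarrow> 'a set \<Rightarrow> ('a, 'f, 'r) interp \<Rightarrow> bool" where
  "pseudo_principal \<Sigma> Z U \<longleftrightarrow>
     (\<forall>F \<in> fsyms \<Sigma>. \<forall>as \<in> nlists (farity \<Sigma> F) Z.
        \<exists>b \<in> Z. filtermap (\<lambda>f. f as) (gop U F) = principal {b})"

definition e_model ::
    "('f, 'r) signature \<Rightarrow> 'a set \<Rightarrow> ('a, 'f, 'r) interp \<Rightarrow> ('a filter, 'f, 'r) model" where
  "e_model \<Sigma> Z U =
     \<lparr>universe = beta Z,
      opn = (\<lambda>F \<in> fsyms \<Sigma>. e_op Z (farity \<Sigma> F) (gop U F)),
      reln = (\<lambda>R \<in> rsyms \<Sigma>. e_rel Z (rarity \<Sigma> R) (grel U R))\<rparr>"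

definition E_model ::
    "('f, 'r) signature \<Rightarrow> 'a set \<Rightarrow> ('a, 'f, 'r) interp \<Rightarrow> ('a filter, 'f, 'r) model" where
  "E_model \<Sigma> Z U =
     \<lparr>universe = beta Z,
      opn = (\<lambda>F \<in> fsyms \<Sigma>. e_op Z (farity \<Sigma> F) (gop U F)),
      reln = (\<lambda>R \<in> rsyms \<Sigma>. E_rel Z (rarity \<Sigma> R) (grel U R))\<rparr>"

text \<open>
  The submodel of \<open>e_model \<Sigma> Z U\<close> on the principal ultrafilters, transported to \<open>Z\<close> along
  \<open>z \<mapsto> principal {z}\<close>.  The definite description denotes as soon as the principal
  ultrafilters are closed under the operations, in particular in the pseudo-principal case.
\<close>

definition principal_submodel ::
    "('f, 'r) signature \<Rightarrow> 'a set \<Rightarrow> ('a, 'f, 'r) interp \<Rightarrow> ('a, 'f, 'r) model" where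
  "principal_submodel \<Sigma> Z U =
     \<lparr>universe = Z,
      opn = (\<lambda>F \<in> fsyms \<Sigma>. \<lambda>xs \<in> nlists (farity \<Sigma> F) Z.
        THE z. z \<in> Z \<and> principal {z} = opn (e_model \<Sigma> Z U) F (map (\<lambda>x. principal {x}) xs)),
      reln = (\<lambda>R \<in> rsyms \<Sigma>. {xs \<in> nlists (rarity \<Sigma> R) Z.
        map (\<lambda>x. principal {x}) xs \<in> reln (e_model \<Sigma> Z U) R})\<rparr>"

definition generalized_homomorphism ::
    "('f, 'r) signature \<Rightarrow> 'a set \<Rightarrow> ('a, 'f, 'r) interp \<Rightarrow> 'b set \<Rightarrow> ('b, 'f, 'r) interp \<Rightarrow>
      ('a filter \<Rightarrow> 'b filter) \<Rightarrow> bool" where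
  "generalized_homomorphism \<Sigma> X U Y V g \<longleftrightarrow> homomorphism \<Sigma> (e_model \<Sigma> X U) (e_model \<Sigma> Y V) g"

end

theory Submission
  imports Defs
begin

text \<open>
  A right continuous operation is determined by its values on tuples of principal ultrafilters,
  and these values can be prescribed arbitrarily: the operation is then an iterated limit.  The
  maps \<open>e\<close> therefore have the closed form
  \<open>\<forall>\<^sup>u\<^sup>1 z\<^sub>1 \<dots> \<forall>\<^sup>u\<^sup>n z\<^sub>n \<forall>\<^sup>r f. f (z\<^sub>1, \<dots>, z\<^sub>n) \<in> A\<close>, and similarly for relations, so that
  \<open>e(r)\<close> and \<open>E(r)\<close> are the two ultrafilter extensions of the single relation of those \<open>z\<close>
  with \<open>\<forall>\<^sup>r Q. z \<in> Q\<close>.  All five homomorphism conditions then reduce to the same condition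
  on tuples of elements of \<open>X\<close>.
\<close>


section \<open>Ultrafilters\<close>

lemma beta_eventually_not:
  "u \<in> beta Z \<Longrightarrow> (\<forall>\<^sub>F z in u. \<not> P z) \<longleftrightarrow> \<not> eventually P u"
  unfolding beta_def using eventually_conj[of P u "\<lambda>z. \<not> P z"] by (auto simp: trivial_limit_def)

lemma beta_eventually_carrier: "u \<in> beta Z \<Longrightarrow> \<forall>\<^sub>F z in u. z \<in> Z"
  by (auto simp: beta_def le_principal)

text \<open>One equivalence covers properness and the dichotomy: at the constantly true predicate it
  excludes \<open>bot\<close>.\<close>

lemma betaI:
  assumes "\<And>P. (\<forall>\<^sub>F z in u. \<not> P z) \<longleftrightarrow> \<not> eventually P u" and "\<forall>\<^sub>F z in u. z \<in> Z"
  shows "u \<in> beta Z"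
  using assms(1)[of "\<lambda>_. True"] assms by (auto simp: beta_def le_principal trivial_limit_def)

lemma principal_in_beta [simp]: "principal {z} \<in> beta Z \<longleftrightarrow> z \<in> Z"
  by (auto simp: beta_def eventually_principal principal_eq_bot_iff)

lemma filtermap_in_beta:
  assumes "u \<in> beta X" and "h \<in> X \<rightarrow> Y"
  shows "filtermap h u \<in> beta Y"
proof (rule betaI)
  show "(\<forall>\<^sub>F z in filtermap h u. \<not> P z) \<longleftrightarrow> \<not> eventually P (filtermap h u)" for P
    using beta_eventually_not[OF assms(1)] by (simp add: eventually_filtermap)
  show "\<forall>\<^sub>F z in filtermap h u. z \<in> Y"
    using beta_eventually_carrier[OF assms(1)] assms(2)
    by (auto simp: eventually_filtermap elim!: eventually_mono)
qed

text \<open>Filters are ordered by reverse inclusion, so this is maximality of ultrafilters: a set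
  of \<open>v\<close> missing from \<open>u\<close> has its complement in \<open>u\<close>, hence in
  \<open>v\<close>, and \<open>v\<close> would be \<open>bot\<close>.\<close>

lemma beta_le_imp_eq:
  assumes "u \<in> beta Z" and "v \<noteq> bot" and "v \<le> u"
  shows "v = u"
proof (rule antisym[OF assms(3)], rule filter_leI)
  fix P assume P: "eventually P v"
  show "eventually P u"
  proof (rule ccontr)
    assume "\<not> eventually P u"
    then have "\<forall>\<^sub>F z in v. \<not> P z"
      using beta_eventually_not[OF assms(1)] assms(3) by (auto intro: filter_leD)
    with P have "\<forall>\<^sub>F z in v. False" by eventually_elim simp
    with assms(2) show False by (simp add: trivial_limit_def)
  qed
qed

text \<open>The ultrafilter lemma: Zorn's lemma for the reversed order gives a minimal proper filter
  \<open>m\<close> below \<open>F\<close>, and minimality makes it an ultrafilter.\<close>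

lemma ultrafilter_below:
  assumes "F \<noteq> bot" and "F \<le> principal Z"
  shows "\<exists>u \<in> beta Z. u \<le> F"
proof -
  let ?A = "{G. G \<noteq> bot \<and> G \<le> F}"
  have "\<exists>m \<in> ?A. \<forall>a \<in> ?A. m \<ge> a \<longrightarrow> a = m"
  proof (rule predicate_Zorn)
    show "partial_order_on ?A (relation_of (\<ge>) ?A)"
      by (auto simp: partial_order_on_def preorder_on_def relation_of_def refl_on_def trans_def
          antisym_def)
    fix C assume C: "C \<in> Chains (relation_of (\<ge>) ?A)"
    show "\<exists>u \<in> ?A. \<forall>a \<in> C. u \<le> a"
    proof (cases "C = {}")
      case True
      with assms show ?thesis by auto
    next
      case False
      have sub: "C \<subseteq> ?A" and tot: "\<And>a b. a \<in> C \<Longrightarrow> b \<in> C \<Longrightarrow> a \<le> b \<or> b \<le> a"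
        using C by (auto simp: Chains_def relation_of_def)
      \<comment> \<open>A set lies in the infimum of a nonempty chain only if it lies in some
        member. No member contains the empty set, so neither does the infimum.\<close>
      have "eventually P (Inf C) \<longleftrightarrow> (\<exists>b\<in>C. eventually P b)" for P
        by (rule eventually_Inf_base[OF False]) (metis tot inf.absorb1 inf.absorb2)
      then have "Inf C \<noteq> bot"
        using sub by (auto simp: trivial_limit_def)
      moreover have "Inf C \<le> F"
        using False sub by (auto intro: Inf_lower2)
      ultimately show ?thesis by (auto intro: Inf_lower)
    qed
  qed
  then obtain m where m: "m \<noteq> bot" "m \<le> F" and max: "\<And>a. a \<noteq> bot \<Longrightarrow> a \<le> m \<Longrightarrow> a = m"
    by (auto intro: order_trans)
  have "eventually P m \<or> (\<forall>\<^sub>F z in m. \<not> P z)" for P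
  \<comment> \<open>If adding the set of \<open>P\<close> to \<open>m\<close> yields
    \<open>bot\<close>, its complement is already in \<open>m\<close>; otherwise minimality puts the
    set itself into \<open>m\<close>.\<close>
  proof (cases "inf m (principal {z. P z}) = bot")
    case True
    then show ?thesis by (simp add: trivial_limit_def eventually_inf_principal)
  next
    case False
    from max[OF False] have "m \<le> principal {z. P z}" by (metis inf.cobounded1 inf.cobounded2)
    then show ?thesis by (simp add: le_principal)
  qed
  then have "m \<in> beta Z"
    using m assms(2) by (auto simp: beta_def intro: order_trans)
  with m show ?thesis by blast
qed


section \<open>Iterated ultrafilter quantifiers\<close>

lemma iter_ev_cong:
  assumes "us \<in> nlists n (beta Z)" and "\<And>zs. zs \<in> nlists n Z \<Longrightarrow> P zs \<longleftrightarrow> Q zs"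
  shows "iter_ev us P \<longleftrightarrow> iter_ev us Q"
  using assms
proof (induction us arbitrary: n P Q)
  case Nil
  have "n = 0" using nlistsE_length[OF Nil.prems(1)] by simp
  with Nil.prems(2)[of "[]"] show ?case by simp
next
  case (Cons u us)
  obtain m where m: "n = Suc m" "u \<in> beta Z" "us \<in> nlists m (beta Z)"
    using Cons.prems(1) by auto
  have "\<forall>\<^sub>F z in u. iter_ev us (\<lambda>zs. P (z # zs)) = iter_ev us (\<lambda>zs. Q (z # zs))"
    using beta_eventually_carrier[OF m(2)]
    by eventually_elim (rule Cons.IH[OF m(3)], use Cons.prems(2) m in auto)
  then show ?case unfolding iter_ev.simps by (rule eventually_cong)
qed

text \<open>Negation passes through each ultrafilter quantifier in turn, so the iterated quantifier
  is again that of an ultrafilter on tuples.\<close>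

lemma iter_ev_not:
  "us \<in> nlists n (beta Z) \<Longrightarrow> iter_ev us (\<lambda>zs. \<not> P zs) \<longleftrightarrow> \<not> iter_ev us P"
proof (induction us arbitrary: n P)
  case (Cons u us)
  then show ?case by (auto simp: beta_eventually_not)
qed simp

lemma iter_ev_nlists:
  assumes "us \<in> nlists n (beta Z)"
  shows "iter_ev us (\<lambda>zs. zs \<in> nlists n Z)"
proof -
  have "iter_ev us (\<lambda>zs. zs \<in> nlists n Z) \<longleftrightarrow> iter_ev us (\<lambda>_. True)"
    by (rule iter_ev_cong[OF assms]) simp
  then show ?thesis by (simp add: iter_ev_True)
qed

lemma iter_ev_principal [simp]: "iter_ev (map (\<lambda>z. principal {f z}) zs) P \<longleftrightarrow> P (map f zs)"
  by (induction zs arbitrary: P) (auto simp: eventually_principal)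

lemma iter_ev_filtermap: "iter_ev (map (filtermap h) us) P \<longleftrightarrow> iter_ev us (\<lambda>zs. P (map h zs))"
  by (induction us arbitrary: P) (auto simp: eventually_filtermap)

text \<open>Principal ultrafilters before position \<open>i\<close> merely substitute their points,
  so \<open>u\<close> becomes the outermost quantifier; those after it are absorbed into
  \<open>Q\<close>, which does not depend on \<open>u\<close>. This is right continuity in
  combinatorial form.\<close>

lemma iter_ev_update:
  assumes "i < length us" and "\<And>j. j < i \<Longrightarrow> \<exists>z. us ! j = principal {z}"
  shows "\<exists>Q. \<forall>u. iter_ev (us[i := u]) P \<longleftrightarrow> eventually Q u"
  using assms
proof (induction us arbitrary: i P)
  case (Cons u us)
  show ?case
  proof (cases i)
    case 0
    then show ?thesis by auto
  next
    case (Suc k)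
    obtain z where z: "u = principal {z}" using Cons.prems(2)[of 0] Suc by auto
    have "\<exists>Q. \<forall>v. iter_ev (us[k := v]) (\<lambda>zs. P (z # zs)) \<longleftrightarrow> eventually Q v"
      using Cons.prems Suc by (intro Cons.IH) force+
    then show ?thesis by (simp add: Suc z eventually_principal)
  qed
qed simp


section \<open>Topology\<close>

lemma topspace_beta_top [simp]: "topspace (beta_top Z) = beta Z"
  by (auto simp: beta_top_def dest: beta_eventually_carrier)

lemma openin_beta_top: "openin (beta_top Z) {u \<in> beta Z. eventually P u}"
proof -
  have "{u \<in> beta Z. eventually P u} = {u \<in> beta Z. \<forall>\<^sub>F z in u. z \<in> {z \<in> Z. P z}}"
    using beta_eventually_carrier by (auto simp: eventually_conj_iff)
  then show ?thesis
    unfolding beta_top_def by (intro topology_generated_by_Basis) blast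
qed

lemma continuous_map_into_beta_top:
  assumes "\<And>u. u \<in> topspace T \<Longrightarrow> F u \<in> beta Z"
    and "\<And>P. openin T {u \<in> topspace T. eventually P (F u)}"
  shows "continuous_map T (beta_top Z) F"
  unfolding beta_top_def
proof (rule continuous_on_generated_topo)
  fix U assume "U \<in> {{u \<in> beta Z. \<forall>\<^sub>F z in u. z \<in> A} |A. A \<subseteq> Z}"
  then obtain A where "U = {u \<in> beta Z. \<forall>\<^sub>F z in u. z \<in> A}" by auto
  then have "F -` U \<inter> topspace T = {u \<in> topspace T. \<forall>\<^sub>F z in F u. z \<in> A}"
    using assms(1) by auto
  with assms(2) show "openin T (F -` U \<inter> topspace T)" by simp
next
  show "F ` topspace T \<subseteq> \<Union> {{u \<in> beta Z. \<forall>\<^sub>F z in u. z \<in> A} |A. A \<subseteq> Z}"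
    using assms(1) topspace_beta_top[of Z] unfolding beta_top_def by auto
qed

lemma continuous_map_beta_top_discrete:
  "continuous_map (beta_top Z) (discrete_topology UNIV) (\<lambda>u. eventually P u)"
  unfolding continuous_map_def
proof (intro conjI allI impI)
  fix U :: "bool set"
  have "openin (beta_top Z) {u \<in> beta Z. eventually (\<lambda>z. P z) u \<in> {b}}" for b
  proof (cases b)
    case False
    then have "{u \<in> beta Z. eventually P u \<in> {b}} = {u \<in> beta Z. \<forall>\<^sub>F z in u. \<not> P z}"
      by (auto simp: beta_eventually_not)
    then show ?thesis using openin_beta_top by metis
  qed (simp add: openin_beta_top)
  then have "openin (beta_top Z) (\<Union>b\<in>U. {u \<in> beta Z. eventually P u \<in> {b}})"
    by blast
  moreover have "(\<Union>b\<in>U. {u \<in> beta Z. eventually P u \<in> {b}}) = {u \<in> beta Z. eventually P u \<in> U}"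
    by auto
  ultimately show "openin (beta_top Z) {x \<in> topspace (beta_top Z). eventually P x \<in> U}"
    by simp
qed simp

lemma Hausdorff_beta_top: "Hausdorff_space (beta_top Z)"
  unfolding Hausdorff_space_def
proof (intro allI impI)
  fix u v assume uv: "u \<in> topspace (beta_top Z) \<and> v \<in> topspace (beta_top Z) \<and> u \<noteq> v"
  \<comment> \<open>If every set of \<open>u\<close> belonged to \<open>v\<close>, then
    \<open>v\<close> would be below \<open>u\<close> and hence equal to it.\<close>
  then obtain P where P: "eventually P u" "\<not> eventually P v"
    using beta_le_imp_eq[of u Z v] by (auto simp: beta_def le_filter_def)
  with uv have "v \<in> {v \<in> beta Z. \<forall>\<^sub>F z in v. \<not> P z}" "u \<in> {u \<in> beta Z. eventually P u}"
    by (auto simp: beta_eventually_not)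
  moreover have "disjnt {u \<in> beta Z. eventually P u} {v \<in> beta Z. \<forall>\<^sub>F z in v. \<not> P z}"
    by (auto simp: disjnt_def beta_eventually_not)
  ultimately show "\<exists>U V. openin (beta_top Z) U \<and> openin (beta_top Z) V \<and> u \<in> U \<and> v \<in> V \<and> disjnt U V"
    using openin_beta_top[of Z] by blast
qed

text \<open>The generating sets are closed under intersection, since predicates can be conjoined, so
  they form a base and not just a subbase.\<close>

lemma generated_beta_top_base:
  assumes "generate_topology_on {{u \<in> beta Z. \<forall>\<^sub>F z in u. z \<in> A} | A. A \<subseteq> Z} U" and "u \<in> U"
  shows "\<exists>P. eventually P u \<and> {v \<in> beta Z. eventually P v} \<subseteq> U"
  using assms
proof induction
  case (Int a b)
  then obtain P Q where "eventually P u" "{v \<in> beta Z. eventually P v} \<subseteq> a"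
    "eventually Q u" "{v \<in> beta Z. eventually Q v} \<subseteq> b"
    by blast
  then show ?case by (intro exI[of _ "\<lambda>z. P z \<and> Q z"]) (auto simp: eventually_conj_iff)
next
  case (UN K)
  then show ?case by (meson Union_iff Union_upper order_trans)
next
  case (Basis s)
  then show ?case by auto
qed simp

section \<open>Density of the points and uniqueness of right continuous maps\<close>

lemma principal_dense: "beta Z \<subseteq> beta_top Z closure_of ((\<lambda>z. principal {z}) ` Z)"
proof
  fix u assume u: "u \<in> beta Z"
  have "\<exists>y. y \<in> (\<lambda>z. principal {z}) ` Z \<and> y \<in> U" if "u \<in> U" "openin (beta_top Z) U" for U
  proof -
    have "generate_topology_on {{u \<in> beta Z. \<forall>\<^sub>F z in u. z \<in> A} | A. A \<subseteq> Z} U"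
      using that(2) by (simp add: beta_top_def openin_topology_generated_by_iff)
    from generated_beta_top_base[OF this that(1)] obtain P
      where P: "eventually P u" "{v \<in> beta Z. eventually P v} \<subseteq> U" by blast
    have "\<forall>\<^sub>F z in u. z \<in> Z \<and> P z"
      using P(1) beta_eventually_carrier[OF u] by (simp add: eventually_conj_iff)
    \<comment> \<open>A set in a proper filter is nonempty; any element of this one gives a point in
      the given neighbourhood of \<open>u\<close>.\<close>
    then obtain z where "z \<in> Z" "P z"
      using u eventually_happens'[of u] by (auto simp: beta_def)
    then have "principal {z} \<in> U" using P(2) by (auto simp: eventually_principal)
    with \<open>z \<in> Z\<close> show ?thesis by blast
  qed
  with u show "u \<in> beta_top Z closure_of ((\<lambda>z. principal {z}) ` Z)"
    by (auto simp: in_closure_of)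
qed

lemma continuous_map_beta_eqI:
  assumes "continuous_map (beta_top Z) T f" and "continuous_map (beta_top Z) T g"
    and "Hausdorff_space T" and "\<And>z. z \<in> Z \<Longrightarrow> f (principal {z}) = g (principal {z})"
    and "u \<in> beta Z"
  shows "f u = g u"
  by (rule forall_in_closure_of_eq[OF subsetD[OF principal_dense assms(5)] assms(3,1,2)])
     (elim imageE, simp add: assms(4))

lemma map_principal_in_nlists [simp]:
  "map (\<lambda>z. principal {z}) zs \<in> nlists n (beta Z) \<longleftrightarrow> zs \<in> nlists n Z"
  by (auto simp: nlists_def simp del: nlistsE_set nlistsE_length)

text \<open>Density is applied to one argument at a time, from the last to the first. When position
  \<open>i\<close> is freed, everything before it is still a point, which is exactly where
  continuity is available.\<close>

lemma rc_eqI: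
  assumes F: "F \<in> rc Z n T" and G: "G \<in> rc Z n T" and T: "Hausdorff_space T"
    and eq: "\<And>zs. zs \<in> nlists n Z \<Longrightarrow>
      F (map (\<lambda>z. principal {z}) zs) = G (map (\<lambda>z. principal {z}) zs)"
  shows "F = G"
proof -
  \<comment> \<open>\<open>k\<close> counts the trailing arguments that may be arbitrary:
    \<open>k = 0\<close> is agreement on points, \<open>k = n\<close> the claim.\<close>
  have *: "F us = G us" if "k \<le> n" "us \<in> nlists n (beta Z)"
    "\<forall>j<n - k. \<exists>z\<in>Z. us ! j = principal {z}" for k us
    using that
  proof (induction k arbitrary: us)
    case 0
    then have "\<forall>j<n. \<exists>z. z \<in> Z \<and> us ! j = principal {z}" by auto
    then obtain f where f: "\<And>j. j < n \<Longrightarrow> f j \<in> Z" "\<And>j. j < n \<Longrightarrow> us ! j = principal {f j}"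
      by metis
    have "us = map (\<lambda>z. principal {z}) (map f [0..<n])"
      using 0 f(2) by (intro nth_equalityI) simp_all
    moreover have "map f [0..<n] \<in> nlists n Z"
      using f(1) by (intro nlistsI) auto
    ultimately show ?case using eq[of "map f [0..<n]"] by (simp only:)
  next
    case (Suc k)
    \<comment> \<open>The first of the \<open>Suc k\<close> free positions; with a point put there,
      only \<open>k\<close> remain free.\<close>
    define i where "i = n - Suc k"
    have i: "i < n" "n - k = Suc i" using Suc.prems(1) by (auto simp: i_def)
    have pr: "\<forall>j<i. \<exists>z\<in>Z. us ! j = principal {z}" using Suc.prems by (simp add: i_def)
    \<comment> \<open>This form of \<open>us\<close> exhibits both sides as values of functions of
      the argument at \<open>i\<close>.\<close>
    have "F (us[i := us ! i]) = G (us[i := us ! i])"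
    proof (rule continuous_map_beta_eqI[where f = "\<lambda>u. F (us[i := u])" and g = "\<lambda>u. G (us[i := u])"])
      show "continuous_map (beta_top Z) T (\<lambda>u. F (us[i := u]))"
        "continuous_map (beta_top Z) T (\<lambda>u. G (us[i := u]))"
        using F G i pr Suc.prems(2) unfolding rc_def by blast+
      show "us ! i \<in> beta Z" using Suc.prems i by (simp add: nlistsE_nth_in)
      fix z assume z: "z \<in> Z"
      show "F (us[i := principal {z}]) = G (us[i := principal {z}])"
      proof (rule Suc.IH)
        show "us[i := principal {z}] \<in> nlists n (beta Z)" using Suc.prems(2) z by simp
        show "\<forall>j<n - k. \<exists>w\<in>Z. us[i := principal {z}] ! j = principal {w}"
          using i pr z Suc.prems(2) by (auto simp: less_Suc_eq)
      qed (use Suc.prems in simp)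
    qed (rule T)
    then show ?case by simp
  qed
  show ?thesis
  proof (rule extensionalityI)
    show "F \<in> extensional (nlists n (beta Z))" "G \<in> extensional (nlists n (beta Z))"
      using F G by (auto simp: rc_def PiE_def)
  qed (use *[of n] in simp)
qed

section \<open>Recognizing the continuous extension into a space of right continuous maps\<close>

lemma continuous_map_into_rc_top:
  assumes "\<And>r. r \<in> topspace S \<Longrightarrow> G r \<in> rc Z n T"
    and "\<And>zs. zs \<in> nlists n Z \<Longrightarrow> continuous_map S T (\<lambda>r. G r (map (\<lambda>z. principal {z}) zs))"
  shows "continuous_map S (rc_top Z n T) G"
  unfolding rc_top_def
  by (rule continuous_map_pullback')
     (use assms in \<open>auto simp: continuous_map_componentwise o_def\<close>)

lemma continuous_map_rc_top_eval:
  assumes "zs \<in> nlists n Z"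
  shows "continuous_map (rc_top Z n T) T (\<lambda>F. F (map (\<lambda>z. principal {z}) zs))"
proof -
  have "continuous_map (rc_top Z n T) T
    ((\<lambda>x. x zs) \<circ> (\<lambda>F. \<lambda>zs \<in> nlists n Z. F (map (\<lambda>z. principal {z}) zs)))"
    unfolding rc_top_def
    using continuous_map_product_coordinates[OF assms, of "\<lambda>_. T"]
    by (rule continuous_map_pullback)
  then show ?thesis using assms by (simp add: o_def)
qed

text \<open>Uniqueness uses density twice: over \<open>S\<close>, to compare two candidates at a
  fixed tuple of points, and over \<open>Z\<close>, through \<open>rc_eqI\<close>, to pass from
  points to all tuples. Existence is settled by the given \<open>g\<close>.\<close>

lemma cont_ext_rc_top_eqI:
  assumes T: "Hausdorff_space T" and ext: "g \<in> extensional (beta S)"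
    and rc: "\<And>r. r \<in> beta S \<Longrightarrow> g r \<in> rc Z n T"
    and cont: "\<And>zs. zs \<in> nlists n Z \<Longrightarrow>
      continuous_map (beta_top S) T (\<lambda>r. g r (map (\<lambda>z. principal {z}) zs))"
    and val: "\<And>s. s \<in> S \<Longrightarrow> g (principal {s}) = \<phi> s"
  shows "cont_ext S (rc_top Z n T) \<phi> = g"
  unfolding cont_ext_def
proof (rule the_equality)
  show "g \<in> extensional (beta S) \<and> continuous_map (beta_top S) (rc_top Z n T) g \<and>
      (\<forall>s\<in>S. g (principal {s}) = \<phi> s)"
    using assms by (auto intro!: continuous_map_into_rc_top)
  fix g' assume g': "g' \<in> extensional (beta S) \<and> continuous_map (beta_top S) (rc_top Z n T) g' \<and>
      (\<forall>s\<in>S. g' (principal {s}) = \<phi> s)"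
  show "g' = g"
  proof (rule extensionalityI)
    show "g' \<in> extensional (beta S)" "g \<in> extensional (beta S)" using g' ext by auto
    fix r assume r: "r \<in> beta S"
    have "g' r \<in> topspace (rc_top Z n T)"
      using g' r by (auto simp: continuous_map_def)
    then have "g' r \<in> rc Z n T" by (simp add: rc_top_def topspace_pullback_topology)
    then show "g' r = g r"
    proof (rule rc_eqI[OF _ rc[OF r] T])
      fix zs assume zs: "zs \<in> nlists n Z"
      have "continuous_map (beta_top S) T (\<lambda>r. g' r (map (\<lambda>z. principal {z}) zs))"
        using continuous_map_compose[OF _ continuous_map_rc_top_eval[OF zs]] g'
        by (force simp: o_def)
      then show "g' r (map (\<lambda>z. principal {z}) zs) = g r (map (\<lambda>z. principal {z}) zs)"
        by (rule continuous_map_beta_eqI[OF _ cont[OF zs] T _ r]) (use g' val in auto)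
    qed
  qed
qed


section \<open>Extensions of interpreting ultrafilters\<close>

lemma map_in_nlists: "xs \<in> nlists n X \<Longrightarrow> h \<in> X \<rightarrow> Y \<Longrightarrow> map h xs \<in> nlists n Y"
  by (auto simp: nlists_def simp del: nlistsE_set nlistsE_length)

text \<open>The iterated limit of the ultrafilters \<open>\<phi> zs\<close> along \<open>us\<close>.
  Unlike in \<open>tilde_op\<close>, the values at points may be nonprincipal, as happens for the
  operations of \<open>e_model\<close>.\<close>

definition ext_op :: "'a set \<Rightarrow> nat \<Rightarrow> ('a list \<Rightarrow> 'a filter) \<Rightarrow> ('a filter list \<Rightarrow> 'a filter)" where
  "ext_op Z n \<phi> = (\<lambda>us \<in> nlists n (beta Z).
     Abs_filter (\<lambda>P. iter_ev us (\<lambda>zs. eventually P (\<phi> zs))))"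

lemma eventually_ext_op:
  assumes "us \<in> nlists n (beta Z)"
  shows "eventually P (ext_op Z n \<phi> us) \<longleftrightarrow> iter_ev us (\<lambda>zs. eventually P (\<phi> zs))"
proof -
  have "is_filter (\<lambda>P. iter_ev us (\<lambda>zs. eventually P (\<phi> zs)))"
  proof (rule is_filter.intro)
    show "iter_ev us (\<lambda>zs. eventually (\<lambda>x. P x \<and> Q x) (\<phi> zs))"
      if "iter_ev us (\<lambda>zs. eventually P (\<phi> zs))" "iter_ev us (\<lambda>zs. eventually Q (\<phi> zs))" for P Q
      using iter_ev_conj[OF that] by (simp add: eventually_conj_iff)
    show "iter_ev us (\<lambda>zs. eventually Q (\<phi> zs))"
      if "\<forall>x. P x \<longrightarrow> Q x" "iter_ev us (\<lambda>zs. eventually P (\<phi> zs))" for P Q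
      using that(2) by (rule iter_ev_mono) (use that(1) in \<open>auto elim: eventually_mono\<close>)
  qed (simp add: iter_ev_True)
  then show ?thesis
    using assms by (simp add: ext_op_def eventually_Abs_filter)
qed

lemma ext_op_principal:
  assumes "map h xs \<in> nlists n Z"
  shows "ext_op Z n \<phi> (map (\<lambda>x. principal {h x}) xs) = \<phi> (map h xs)"
proof (rule filter_eqI)
  have "map (\<lambda>x. principal {h x}) xs \<in> nlists n (beta Z)"
    using map_principal_in_nlists[of "map h xs"] assms by (simp add: o_def)
  then show "eventually P (ext_op Z n \<phi> (map (\<lambda>x. principal {h x}) xs)) \<longleftrightarrow>
      eventually P (\<phi> (map h xs))" for P
    by (simp add: eventually_ext_op)
qed

lemma ext_op_cong:
  assumes "\<And>zs. zs \<in> nlists n Z \<Longrightarrow> \<phi> zs = \<psi> zs"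
  shows "ext_op Z n \<phi> = ext_op Z n \<psi>"
proof (rule extensionalityI[where A = "nlists n (beta Z)"])
  fix us assume us: "us \<in> nlists n (beta Z)"
  show "ext_op Z n \<phi> us = ext_op Z n \<psi> us"
    by (rule filter_eqI, unfold eventually_ext_op[OF us], rule iter_ev_cong[OF us])
       (simp add: assms)
qed (simp_all add: ext_op_def)

lemma ext_op_in_beta:
  assumes "us \<in> nlists n (beta Z)" and "\<And>zs. zs \<in> nlists n Z \<Longrightarrow> \<phi> zs \<in> beta Z"
  shows "ext_op Z n \<phi> us \<in> beta Z"
proof (rule betaI)
  fix P
  have "iter_ev us (\<lambda>zs. \<forall>\<^sub>F z in \<phi> zs. \<not> P z) \<longleftrightarrow> iter_ev us (\<lambda>zs. \<not> eventually P (\<phi> zs))"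
    by (rule iter_ev_cong[OF assms(1)]) (simp add: beta_eventually_not[OF assms(2)])
  then show "(\<forall>\<^sub>F z in ext_op Z n \<phi> us. \<not> P z) \<longleftrightarrow> \<not> eventually P (ext_op Z n \<phi> us)"
    by (simp add: eventually_ext_op[OF assms(1)] iter_ev_not[OF assms(1)])
next
  have "iter_ev us (\<lambda>zs. \<forall>\<^sub>F z in \<phi> zs. z \<in> Z)"
    using iter_ev_nlists[OF assms(1)]
    by (rule iter_ev_mono) (rule beta_eventually_carrier[OF assms(2)])
  then show "\<forall>\<^sub>F z in ext_op Z n \<phi> us. z \<in> Z"
    by (simp add: eventually_ext_op[OF assms(1)])
qed

lemma iter_ev_update_rc:
  assumes "us \<in> nlists n (beta Z)" and "i < n" and "\<forall>j<i. \<exists>z\<in>Z. us ! j = principal {z}"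
  shows "\<exists>Q. \<forall>u. iter_ev (us[i := u]) P \<longleftrightarrow> eventually Q u"
  by (rule iter_ev_update) (use assms in auto)

text \<open>With principal arguments before position \<open>i\<close>, membership of a set in the
  value is a single quantifier over the ultrafilter at \<open>i\<close>, hence an open condition on
  it.\<close>

lemma ext_op_in_rc:
  assumes "\<And>zs. zs \<in> nlists n Z \<Longrightarrow> \<phi> zs \<in> beta Z"
  shows "ext_op Z n \<phi> \<in> rc Z n (beta_top Z)"
proof -
  have "continuous_map (beta_top Z) (beta_top Z) (\<lambda>u. ext_op Z n \<phi> (us[i := u]))"
    if i: "i < n" and us: "us \<in> nlists n (beta Z)"
      and pr: "\<forall>j<i. \<exists>z\<in>Z. us ! j = principal {z}" for i us
  proof (rule continuous_map_into_beta_top)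
    fix P
    obtain Q where Q: "\<And>u. iter_ev (us[i := u]) (\<lambda>zs. eventually P (\<phi> zs)) \<longleftrightarrow> eventually Q u"
      using iter_ev_update_rc[OF us i pr] by blast
    have "{u \<in> beta Z. eventually P (ext_op Z n \<phi> (us[i := u]))} = {u \<in> beta Z. eventually Q u}"
      using us by (auto simp: eventually_ext_op Q)
    then show "openin (beta_top Z) {u \<in> topspace (beta_top Z). eventually P (ext_op Z n \<phi> (us[i := u]))}"
      using openin_beta_top by simp
  qed (use us assms in \<open>auto intro!: ext_op_in_beta\<close>)
  moreover have "ext_op Z n \<phi> \<in> nlists n (beta Z) \<rightarrow>\<^sub>E beta Z"
    using ext_op_in_beta[OF _ assms] by (auto simp: ext_op_def)
  ultimately show ?thesis by (simp add: rc_def)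
qed

section \<open>Closed form of the extension for operations\<close>

lemma tilde_op_eq_ext_op: "tilde_op Z n f = ext_op Z n (\<lambda>zs. principal {f zs})"
  by (simp add: tilde_op_def ext_op_def eventually_principal)

lemma filtermap_eval_in_beta:
  assumes "r \<in> beta (nlists n Z \<rightarrow>\<^sub>E Z)" and "zs \<in> nlists n Z"
  shows "filtermap (\<lambda>f. f zs) r \<in> beta Z"
  by (rule filtermap_in_beta[OF assms(1)]) (use assms(2) in auto)

text \<open>The candidate sends \<open>r\<close> to the iterated limit of its pushforwards under
  evaluation. At a tuple of points it is the pushforward itself, continuous in \<open>r\<close>; at
  a principal \<open>r\<close> the pushforwards are principal and \<open>tilde_op\<close>
  results.\<close>

lemma e_op_eq:
  assumes "r \<in> beta (nlists n Z \<rightarrow>\<^sub>E Z)"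
  shows "e_op Z n r = ext_op Z n (\<lambda>zs. filtermap (\<lambda>f. f zs) r)"
proof -
  let ?S = "nlists n Z \<rightarrow>\<^sub>E Z"
  let ?g = "\<lambda>r \<in> beta ?S. ext_op Z n (\<lambda>zs. filtermap (\<lambda>f. f zs) r)"
  have "cont_ext ?S (rc_top Z n (beta_top Z)) (tilde_op Z n) = ?g"
  proof (rule cont_ext_rc_top_eqI)
    show "?g r \<in> rc Z n (beta_top Z)" if "r \<in> beta ?S" for r
      using that by (simp add: ext_op_in_rc filtermap_eval_in_beta)
    fix zs assume zs: "zs \<in> nlists n Z"
    have ev: "?g r (map (\<lambda>z. principal {z}) zs) = filtermap (\<lambda>f. f zs) r" if "r \<in> beta ?S" for r
      using that zs ext_op_principal[of "\<lambda>z. z" zs n Z] by simp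
    show "continuous_map (beta_top ?S) (beta_top Z) (\<lambda>r. ?g r (map (\<lambda>z. principal {z}) zs))"
    proof (rule continuous_map_into_beta_top)
      show "?g r (map (\<lambda>z. principal {z}) zs) \<in> beta Z" if "r \<in> topspace (beta_top ?S)" for r
        using that zs unfolding topspace_beta_top by (subst ev) (auto intro: filtermap_eval_in_beta)
      fix P
      have "{r \<in> beta ?S. eventually P (?g r (map (\<lambda>z. principal {z}) zs))} =
          {r \<in> beta ?S. \<forall>\<^sub>F f in r. P (f zs)}"
        by (intro Collect_cong conj_cong refl) (simp only: ev eventually_filtermap)
      then show "openin (beta_top ?S)
          {r \<in> topspace (beta_top ?S). eventually P (?g r (map (\<lambda>z. principal {z}) zs))}"
        using openin_beta_top by (simp only: topspace_beta_top)
    qed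
  next
    show "?g (principal {f}) = tilde_op Z n f" if "f \<in> ?S" for f
      using that by (simp add: tilde_op_eq_ext_op filtermap_principal)
  qed (simp_all add: Hausdorff_beta_top)
  then show ?thesis using assms by (simp add: e_op_def)
qed

section \<open>Closed form of the extensions for relations\<close>

definition limit_rel :: "'a set \<Rightarrow> nat \<Rightarrow> 'a list set filter \<Rightarrow> 'a list set" where
  "limit_rel Z n r = {zs \<in> nlists n Z. \<forall>\<^sub>F Q in r. zs \<in> Q}"

lemma iter_ev_in_rc:
  "(\<lambda>us \<in> nlists n (beta Z). iter_ev us P) \<in> rc Z n (discrete_topology UNIV)"
proof -
  have "continuous_map (beta_top Z) (discrete_topology UNIV)
      (\<lambda>u. (\<lambda>us \<in> nlists n (beta Z). iter_ev us P) (us[i := u]))"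
    if i: "i < n" and us: "us \<in> nlists n (beta Z)"
      and pr: "\<forall>j<i. \<exists>z\<in>Z. us ! j = principal {z}" for i us
  proof -
    obtain Q where Q: "\<And>u. iter_ev (us[i := u]) P \<longleftrightarrow> eventually Q u"
      using iter_ev_update_rc[OF us i pr] by blast
    show ?thesis
      by (rule continuous_map_eq[OF continuous_map_beta_top_discrete[of Z Q]])
         (use us in \<open>simp add: Q\<close>)
  qed
  then show ?thesis by (simp add: rc_def)
qed

text \<open>\<open>limit_rel\<close> is the pointwise limit along \<open>r\<close> of relations
  viewed as 0-1 functions. At a tuple of points the candidate asks whether the tuple lies in almost
  all relations, a clopen condition on \<open>r\<close>.\<close>

lemma e_rel_eq:
  assumes "r \<in> beta (Pow (nlists n Z))"
  shows "e_rel Z n r = tilde_rel Z n (limit_rel Z n r)"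
proof -
  let ?S = "Pow (nlists n Z)"
  let ?g = "\<lambda>r \<in> beta ?S. \<lambda>us \<in> nlists n (beta Z). iter_ev us (\<lambda>zs. \<forall>\<^sub>F Q in r. zs \<in> Q)"
  have "cont_ext ?S (rc_top Z n (discrete_topology (UNIV :: bool set)))
       (\<lambda>Q. \<lambda>us \<in> nlists n (beta Z). us \<in> tilde_rel Z n Q) = ?g"
  proof (rule cont_ext_rc_top_eqI)
    show "?g r \<in> rc Z n (discrete_topology UNIV)" if "r \<in> beta ?S" for r
      using that by (simp add: iter_ev_in_rc)
    show "continuous_map (beta_top ?S) (discrete_topology UNIV)
        (\<lambda>r. ?g r (map (\<lambda>z. principal {z}) zs))" if "zs \<in> nlists n Z" for zs
      by (rule continuous_map_eq[OF continuous_map_beta_top_discrete[of ?S "\<lambda>Q. zs \<in> Q"]])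
         (use that iter_ev_principal[of "\<lambda>z. z"] in simp)
    show "?g (principal {Q}) = (\<lambda>us \<in> nlists n (beta Z). us \<in> tilde_rel Z n Q)" if "Q \<in> ?S" for Q
      using that by (auto simp: tilde_rel_def eventually_principal)
  qed simp_all
  then have "e_rel Z n r = {us \<in> nlists n (beta Z). iter_ev us (\<lambda>zs. \<forall>\<^sub>F Q in r. zs \<in> Q)}"
    using assms by (auto simp: e_rel_def)
  also have "\<dots> = tilde_rel Z n (limit_rel Z n r)"
    unfolding tilde_rel_def
    by (intro Collect_cong conj_cong refl iter_ev_cong) (auto simp: limit_rel_def)
  finally show ?thesis .
qed

text \<open>A unary relation needs only one quantifier, so its extension consists of the
  ultrafilters containing the limit relation; wrapping into singleton lists commutes with the
  limit.\<close>

lemma e1_rel_eq: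
  assumes "r \<in> beta (Pow (nlists n Z))"
  shows "e1_rel Z n r = {q \<in> beta (nlists n Z). \<forall>\<^sub>F zs in q. zs \<in> limit_rel Z n r}"
proof -
  have "filtermap (\<lambda>R. (\<lambda>x. [x]) ` R) r \<in> beta (Pow (nlists 1 (nlists n Z)))"
    by (rule filtermap_in_beta[OF assms]) auto
  from e_rel_eq[OF this] have "[q] \<in> e_rel (nlists n Z) 1 (filtermap (\<lambda>R. (\<lambda>x. [x]) ` R) r) \<longleftrightarrow>
      q \<in> beta (nlists n Z) \<and> (\<forall>\<^sub>F zs in q. zs \<in> nlists n Z \<and> (\<forall>\<^sub>F Q in r. zs \<in> Q))" for q
    by (simp add: tilde_rel_def limit_rel_def eventually_filtermap image_iff)
  then show ?thesis
    by (simp add: e1_rel_def limit_rel_def)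
qed

section \<open>The star extension as a set of projections\<close>

lemma in_listset_iff: "xs \<in> listset As \<longleftrightarrow> list_all2 (\<in>) xs As"
  by (induction As arbitrary: xs) (auto simp: set_Cons_def list_all2_Cons2)

text \<open>If \<open>Q\<close> meets every box with sides from the \<open>us ! i\<close>, the
  traces of boxes on \<open>Q\<close> form a base of a proper filter, and an ultrafilter
  \<open>q\<close> below it has the required projections. Conversely \<open>q\<close> contains
  \<open>Q\<close> and the finitely many cylinders over the sides, so these have a common
  element.\<close>

lemma star_rel_iff_projections:
  assumes "Q \<subseteq> nlists n Z"
  shows "us \<in> star_rel Z n Q \<longleftrightarrow> (\<exists>q \<in> beta (nlists n Z). (\<forall>\<^sub>F zs in q. zs \<in> Q) \<and>
    us = map (\<lambda>i. filtermap (\<lambda>x. x ! i) q) [0..<n])"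
proof
  assume "us \<in> star_rel Z n Q"
  then have us: "us \<in> nlists n (beta Z)"
    and ne: "\<And>As. list_all2 (\<lambda>A u. A \<subseteq> Z \<and> (\<forall>\<^sub>F z in u. z \<in> A)) As us \<Longrightarrow> Q \<inter> listset As \<noteq> {}"
    by (auto simp: star_rel_def)
  have len: "length us = n" using us by simp
  have nth: "us ! i \<in> beta Z" if "i < n" for i using us that by (rule nlistsE_nth_in)
  define I where "I = {As. list_all2 (\<lambda>A u. A \<subseteq> Z \<and> (\<forall>\<^sub>F z in u. z \<in> A)) As us}"
  have I: "As \<in> I \<longleftrightarrow> length As = n \<and> (\<forall>i<n. As ! i \<subseteq> Z \<and> (\<forall>\<^sub>F z in us ! i. z \<in> As ! i))" for As
    by (auto simp: I_def list_all2_conv_all_nth len)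
  have ls: "xs \<in> listset As \<longleftrightarrow> length xs = n \<and> (\<forall>i<n. xs ! i \<in> As ! i)" if "As \<in> I" for xs As
    using that by (auto simp: in_listset_iff list_all2_conv_all_nth I)
  define F where "F = (INF As\<in>I. principal (Q \<inter> listset As))"
  \<comment> \<open>Boxes constrained in a single coordinate; they determine the projections of
    \<open>q\<close>.\<close>
  have rep: "(replicate n Z)[i := {z \<in> Z. P z}] \<in> I" if "i < n" "eventually P (us ! i)" for i P
    using that beta_eventually_carrier[OF nth]
    by (auto simp: I nth_list_update eventually_conj_iff)
  have repZ: "replicate n Z \<in> I"
    using beta_eventually_carrier[OF nth] by (simp add: I)
  have evF: "eventually P F \<longleftrightarrow> (\<exists>As\<in>I. \<forall>x \<in> Q \<inter> listset As. P x)" for P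
    unfolding F_def
  proof (subst eventually_INF_base)
    show "I \<noteq> {}" using repZ by blast
    fix As Bs assume AB: "As \<in> I" "Bs \<in> I"
    \<comment> \<open>Boxes are intersected side by side, so the family is directed
      downward.\<close>
    let ?C = "map2 (\<inter>) As Bs"
    have C: "?C \<in> I"
      using AB by (auto simp: I eventually_conj_iff)
    moreover have "Q \<inter> listset ?C \<subseteq> (Q \<inter> listset As) \<inter> (Q \<inter> listset Bs)"
      using AB by (auto simp: ls[OF C] ls[OF AB(1)] ls[OF AB(2)] I)
    ultimately show "\<exists>x\<in>I. principal (Q \<inter> listset x) \<le>
        inf (principal (Q \<inter> listset As)) (principal (Q \<inter> listset Bs))"
      by (intro bexI[of _ ?C]) simp_all
  qed (auto simp: eventually_principal)
  have "F \<noteq> bot"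
    using ne by (fastforce simp: trivial_limit_def evF I_def)
  moreover have FQ: "F \<le> principal Q"
    using repZ by (auto simp: le_principal evF)
  moreover have "F \<le> principal (nlists n Z)"
    using FQ assms by (meson order_trans principal_le_iff)
  ultimately obtain q where q: "q \<in> beta (nlists n Z)" "q \<le> F"
    using ultrafilter_below by blast
  \<comment> \<open>One inclusion suffices, as \<open>us ! i\<close> is an ultrafilter and the
    projection is proper.\<close>
  have "filtermap (\<lambda>x. x ! i) q = us ! i" if i: "i < n" for i
  proof (rule beta_le_imp_eq[OF nth[OF i]])
    show "filtermap (\<lambda>x. x ! i) q \<noteq> bot"
      using q(1) by (simp add: beta_def filtermap_bot_iff)
    show "filtermap (\<lambda>x. x ! i) q \<le> us ! i"
    proof (rule filter_leI)
      fix P assume P: "eventually P (us ! i)"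
      have "eventually (\<lambda>x. P (x ! i)) F"
        unfolding evF
      proof (intro bexI[OF _ rep[OF i P]] ballI)
        fix x assume "x \<in> Q \<inter> listset ((replicate n Z)[i := {z \<in> Z. P z}])"
        then have "x ! i \<in> (replicate n Z)[i := {z \<in> Z. P z}] ! i"
          using i ls[OF rep[OF i P]] by blast
        then show "P (x ! i)" using i by simp
      qed
      with q(2) show "eventually P (filtermap (\<lambda>x. x ! i) q)"
        by (auto simp: eventually_filtermap dest: filter_leD)
    qed
  qed
  then have "us = map (\<lambda>i. filtermap (\<lambda>x. x ! i) q) [0..<n]"
    using len by (intro nth_equalityI) simp_all
  moreover have "\<forall>\<^sub>F zs in q. zs \<in> Q"
    using order_trans[OF q(2) FQ] by (simp add: le_principal)
  ultimately show "\<exists>q \<in> beta (nlists n Z). (\<forall>\<^sub>F zs in q. zs \<in> Q) \<and>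
      us = map (\<lambda>i. filtermap (\<lambda>x. x ! i) q) [0..<n]"
    using q(1) by blast
next
  assume "\<exists>q \<in> beta (nlists n Z). (\<forall>\<^sub>F zs in q. zs \<in> Q) \<and>
    us = map (\<lambda>i. filtermap (\<lambda>x. x ! i) q) [0..<n]"
  then obtain q where q: "q \<in> beta (nlists n Z)" "\<forall>\<^sub>F zs in q. zs \<in> Q"
    and us: "us = map (\<lambda>i. filtermap (\<lambda>x. x ! i) q) [0..<n]" by blast
  have "filtermap (\<lambda>x. x ! i) q \<in> beta Z" if "i < n" for i
    by (rule filtermap_in_beta[OF q(1)]) (use that in \<open>auto intro: nlistsE_nth_in\<close>)
  then have "us \<in> nlists n (beta Z)"
    unfolding us by (intro nlistsI) auto
  moreover have "Q \<inter> listset As \<noteq> {}"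
    if "list_all2 (\<lambda>A u. A \<subseteq> Z \<and> (\<forall>\<^sub>F z in u. z \<in> A)) As us" for As
  proof -
    have As: "length As = n" "\<And>i. i < n \<Longrightarrow> \<forall>\<^sub>F x in q. x ! i \<in> As ! i"
      using that by (auto simp: us list_all2_conv_all_nth eventually_filtermap)
    have "\<forall>\<^sub>F x in q. \<forall>i\<in>{..<n}. x ! i \<in> As ! i"
      by (rule eventually_ball_finite) (use As(2) in auto)
    with q(2) have "\<forall>\<^sub>F x in q. x \<in> Q \<and> (\<forall>i\<in>{..<n}. x ! i \<in> As ! i)"
      by (rule eventually_conj)
    then obtain x where x: "x \<in> Q" "\<forall>i\<in>{..<n}. x ! i \<in> As ! i"
      using q(1) eventually_happens'[of q] unfolding beta_def by blast
    then have "length x = n" using assms by auto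
    with x(2) As(1) have "x \<in> listset As"
      by (auto simp: in_listset_iff list_all2_conv_all_nth)
    with x(1) show ?thesis by blast
  qed
  ultimately show "us \<in> star_rel Z n Q" by (simp add: star_rel_def)
qed

lemma E_rel_eq:
  assumes "r \<in> beta (Pow (nlists n Z))"
  shows "E_rel Z n r = star_rel Z n (limit_rel Z n r)"
proof -
  have "limit_rel Z n r \<subseteq> nlists n Z" by (auto simp: limit_rel_def)
  from star_rel_iff_projections[OF this] show ?thesis
    by (auto simp: E_rel_def e1_rel_eq[OF assms])
qed


section \<open>Homomorphisms\<close>

lemma map_principal_image_in_nlists:
  assumes "map h xs \<in> nlists n Z"
  shows "map (\<lambda>x. principal {h x}) xs \<in> nlists n (beta Z)"
  using map_principal_in_nlists[of "map h xs"] assms by (simp add: o_def)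

lemma principal_in_tilde_rel:
  assumes "map h xs \<in> nlists n Z"
  shows "map (\<lambda>x. principal {h x}) xs \<in> tilde_rel Z n Q \<longleftrightarrow> map h xs \<in> Q"
  using map_principal_image_in_nlists[OF assms] by (simp add: tilde_rel_def)

lemma principal_in_star_rel:
  assumes "map h xs \<in> nlists n Z"
  shows "map (\<lambda>x. principal {h x}) xs \<in> star_rel Z n Q \<longleftrightarrow> map h xs \<in> Q"
proof
  assume "map (\<lambda>x. principal {h x}) xs \<in> star_rel Z n Q"
  \<comment> \<open>A box with singleton sides \<open>{h x}\<close> contains only the tuple
    \<open>map h xs\<close>.\<close>
  moreover have "list_all2 (\<lambda>A u. A \<subseteq> Z \<and> (\<forall>\<^sub>F z in u. z \<in> A))
      (map (\<lambda>x. {h x}) xs) (map (\<lambda>x. principal {h x}) xs)"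
    using nlistsE_set[OF assms] by (auto simp: list_all2_conv_all_nth eventually_principal)
  ultimately obtain ys where "ys \<in> Q" "ys \<in> listset (map (\<lambda>x. {h x}) xs)"
    unfolding star_rel_def by blast
  moreover from this(2) have "ys = map h xs"
    by (auto simp: in_listset_iff list_all2_conv_all_nth intro: nth_equalityI)
  ultimately show "map h xs \<in> Q" by simp
next
  assume "map h xs \<in> Q"
  moreover have "map h xs \<in> listset As"
    if "list_all2 (\<lambda>A u. A \<subseteq> Z \<and> (\<forall>\<^sub>F z in u. z \<in> A)) As (map (\<lambda>x. principal {h x}) xs)" for As
    using that by (auto simp: in_listset_iff list_all2_conv_all_nth eventually_principal)
  ultimately show "map (\<lambda>x. principal {h x}) xs \<in> star_rel Z n Q"
    using map_principal_image_in_nlists[OF assms] by (auto simp: star_rel_def)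
qed

section \<open>Reducing the conditions on ultrafilters to conditions on points\<close>

lemma map_filtermap_in_nlists:
  "us \<in> nlists n (beta X) \<Longrightarrow> h \<in> X \<rightarrow> Y \<Longrightarrow> map (filtermap h) us \<in> nlists n (beta Y)"
  by (rule map_in_nlists) (auto intro: filtermap_in_beta)

lemma map_filtermap_principal:
  "map (filtermap h) (map (\<lambda>z. principal {z}) xs) = map (\<lambda>x. principal {h x}) xs"
  by (simp add: filtermap_principal)

text \<open>Points suffice because both sides are iterated limits along the same \<open>us\<close>:
  pushing \<open>us\<close> forward by \<open>h\<close> only composes the predicate with
  \<open>map h\<close>. Leaving \<open>\<phi>\<close> arbitrary lets the rule cover
  \<open>e_op\<close>.\<close>

lemma tilde_op_commute_iff:
  assumes h: "h \<in> X \<rightarrow> Y"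
  shows "(\<forall>us \<in> nlists n (beta X).
      filtermap h (tilde_op X n f us) = ext_op Y n \<phi> (map (filtermap h) us)) \<longleftrightarrow>
    (\<forall>xs \<in> nlists n X. principal {h (f xs)} = \<phi> (map h xs))" (is "?L \<longleftrightarrow> ?R")
proof
  assume L: ?L
  show ?R
  proof
    fix xs assume xs: "xs \<in> nlists n X"
    have "tilde_op X n f (map (\<lambda>z. principal {z}) xs) = principal {f xs}"
      using ext_op_principal[of "\<lambda>z. z" xs n X] xs by (simp add: tilde_op_eq_ext_op)
    moreover have "ext_op Y n \<phi> (map (\<lambda>x. principal {h x}) xs) = \<phi> (map h xs)"
      by (rule ext_op_principal[OF map_in_nlists[OF xs h]])
    ultimately show "principal {h (f xs)} = \<phi> (map h xs)"
      using bspec[OF L, of "map (\<lambda>z. principal {z}) xs"] xs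
      by (simp add: map_filtermap_principal filtermap_principal del: map_map)
  qed
next
  assume R: ?R
  show ?L
  proof (intro ballI filter_eqI)
    fix us P assume us: "us \<in> nlists n (beta X)"
    have "iter_ev us (\<lambda>xs. P (h (f xs))) \<longleftrightarrow> iter_ev us (\<lambda>xs. eventually P (\<phi> (map h xs)))"
      by (rule iter_ev_cong[OF us]) (simp add: bspec[OF R, symmetric] eventually_principal)
    then show "eventually P (filtermap h (tilde_op X n f us)) \<longleftrightarrow>
        eventually P (ext_op Y n \<phi> (map (filtermap h) us))"
      by (simp add: eventually_filtermap eventually_tilde_op[OF us] iter_ev_filtermap
          eventually_ext_op[OF map_filtermap_in_nlists[OF us h]])
  qed
qed

text \<open>At points the extension is the relation itself; the converse is monotonicity of the
  iterated quantifier, restricted to \<open>nlists n X\<close>.\<close>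

lemma tilde_rel_preserve_iff:
  assumes h: "h \<in> X \<rightarrow> Y"
  shows "(\<forall>us \<in> nlists n (beta X).
      us \<in> tilde_rel X n Q \<longrightarrow> map (filtermap h) us \<in> tilde_rel Y n Q') \<longleftrightarrow>
    (\<forall>xs \<in> nlists n X. xs \<in> Q \<longrightarrow> map h xs \<in> Q')" (is "?L \<longleftrightarrow> ?R")
proof
  assume L: ?L
  show ?R
  proof (intro ballI impI)
    fix xs assume xs: "xs \<in> nlists n X" "xs \<in> Q"
    then have "map (\<lambda>z. principal {z}) xs \<in> tilde_rel X n Q"
      using principal_in_tilde_rel[of "\<lambda>z. z" xs n X Q] by simp
    then have "map (filtermap h) (map (\<lambda>z. principal {z}) xs) \<in> tilde_rel Y n Q'"
      using L xs(1) by (simp del: map_map)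
    then show "map h xs \<in> Q'"
      unfolding map_filtermap_principal principal_in_tilde_rel[OF map_in_nlists[OF xs(1) h]] .
  qed
next
  assume R: ?R
  show ?L
  proof (intro ballI impI)
    fix us assume us: "us \<in> nlists n (beta X)" "us \<in> tilde_rel X n Q"
    then have "iter_ev us (\<lambda>xs. xs \<in> nlists n X \<and> xs \<in> Q)"
      by (intro iter_ev_conj iter_ev_nlists) (auto simp: tilde_rel_def)
    then have "iter_ev us (\<lambda>xs. map h xs \<in> Q')"
      by (rule iter_ev_mono) (use R in blast)
    then show "map (filtermap h) us \<in> tilde_rel Y n Q'"
      using map_filtermap_in_nlists[OF us(1) h] by (simp add: tilde_rel_def iter_ev_filtermap)
  qed
qed

text \<open>A witness \<open>q\<close> for \<open>us\<close> is pushed forward by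
  \<open>map h\<close>: the result concentrates on \<open>Q'\<close>, and its projections are the
  images under \<open>h\<close> of those of \<open>q\<close>.\<close>

lemma star_rel_preserve_iff:
  assumes h: "h \<in> X \<rightarrow> Y" and Q: "Q \<subseteq> nlists n X" and Q': "Q' \<subseteq> nlists n Y"
  shows "(\<forall>us \<in> nlists n (beta X).
      us \<in> star_rel X n Q \<longrightarrow> map (filtermap h) us \<in> star_rel Y n Q') \<longleftrightarrow>
    (\<forall>xs \<in> nlists n X. xs \<in> Q \<longrightarrow> map h xs \<in> Q')" (is "?L \<longleftrightarrow> ?R")
proof
  assume L: ?L
  show ?R
  proof (intro ballI impI)
    fix xs assume xs: "xs \<in> nlists n X" "xs \<in> Q"
    then have "map (\<lambda>z. principal {z}) xs \<in> star_rel X n Q"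
      using principal_in_star_rel[of "\<lambda>z. z" xs n X Q] by simp
    then have "map (filtermap h) (map (\<lambda>z. principal {z}) xs) \<in> star_rel Y n Q'"
      using L xs(1) by (simp del: map_map)
    then show "map h xs \<in> Q'"
      unfolding map_filtermap_principal principal_in_star_rel[OF map_in_nlists[OF xs(1) h]] .
  qed
next
  assume R: ?R
  show ?L
  proof (intro ballI impI)
    fix us assume "us \<in> star_rel X n Q"
    then obtain q where q: "q \<in> beta (nlists n X)" "\<forall>\<^sub>F xs in q. xs \<in> Q"
      and us: "us = map (\<lambda>i. filtermap (\<lambda>x. x ! i) q) [0..<n]"
      unfolding star_rel_iff_projections[OF Q] by blast
    let ?q = "filtermap (map h) q"
    have "?q \<in> beta (nlists n Y)"
      by (rule filtermap_in_beta[OF q(1)]) (use h in \<open>auto intro: map_in_nlists\<close>)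
    moreover have "\<forall>\<^sub>F ys in ?q. ys \<in> Q'"
      using q(2) R Q by (auto simp: eventually_filtermap elim!: eventually_mono)
    \<comment> \<open>Indexing commutes with \<open>map h\<close> below the length of a list, so the
      functions are compared only on \<open>nlists n X\<close>, which \<open>q\<close>
      contains.\<close>
    moreover have "filtermap h (filtermap (\<lambda>x. x ! i) q) = filtermap (\<lambda>y. y ! i) ?q" if "i < n" for i
    proof -
      have "\<forall>\<^sub>F x in q. h (x ! i) = map h x ! i"
        using beta_eventually_carrier[OF q(1)] by eventually_elim (use that in simp)
      then show ?thesis
        by (intro filter_eqI, unfold filtermap_filtermap eventually_filtermap)
           (erule eventually_cong, simp)
    qed
    then have "map (filtermap h) us = map (\<lambda>i. filtermap (\<lambda>y. y ! i) ?q) [0..<n]"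
      unfolding us by simp
    ultimately show "map (filtermap h) us \<in> star_rel Y n Q'"
      unfolding star_rel_iff_projections[OF Q'] by blast
  qed
qed

section \<open>The five homomorphism conditions as one condition on points\<close>

theorem theorem33:
  fixes \<Sigma> :: "('f, 'r) signature"
    and X :: "'x set" and Y :: "'y set"
    and U :: "('x, 'f, 'r) interp" and V :: "('y, 'f, 'r) interp"
    and A :: "('x, 'f, 'r) model"
    and h :: "'x \<Rightarrow> 'y"
  assumes "generalized_model \<Sigma> X U"
    and "generalized_model \<Sigma> Y V"
    and "pseudo_principal \<Sigma> X U"
    and "A = principal_submodel \<Sigma> X U"
    and "h \<in> X \<rightarrow> Y"
  shows "tilde_model \<Sigma> A = e_model \<Sigma> X U \<and> star_model \<Sigma> A = E_model \<Sigma> X U \<and>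
    (let i = homomorphism \<Sigma> A (e_model \<Sigma> Y V) (\<lambda>x. principal {h x});
         ii = homomorphism \<Sigma> A (E_model \<Sigma> Y V) (\<lambda>x. principal {h x});
         iii = generalized_homomorphism \<Sigma> X U Y V (filtermap h);
         iv = homomorphism \<Sigma> (tilde_model \<Sigma> A) (e_model \<Sigma> Y V) (filtermap h);
         v = homomorphism \<Sigma> (star_model \<Sigma> A) (E_model \<Sigma> Y V) (filtermap h)
     in (i \<longleftrightarrow> ii) \<and> (i \<longleftrightarrow> iii) \<and> (i \<longleftrightarrow> iv) \<and> (i \<longleftrightarrow> v))"
proof -
  note h = assms(5)
  let ?fa = "farity \<Sigma>" and ?ra = "rarity \<Sigma>"
  have gU: "\<And>F. F \<in> fsyms \<Sigma> \<Longrightarrow> gop U F \<in> beta (nlists (?fa F) X \<rightarrow>\<^sub>E X)"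
      "\<And>R. R \<in> rsyms \<Sigma> \<Longrightarrow> grel U R \<in> beta (Pow (nlists (?ra R) X))"
    and gV: "\<And>F. F \<in> fsyms \<Sigma> \<Longrightarrow> gop V F \<in> beta (nlists (?fa F) Y \<rightarrow>\<^sub>E Y)"
      "\<And>R. R \<in> rsyms \<Sigma> \<Longrightarrow> grel V R \<in> beta (Pow (nlists (?ra R) Y))"
    using assms(1,2) by (auto simp: generalized_model_def)
  have uA: "universe A = X" by (simp add: assms(4) principal_submodel_def)
  \<comment> \<open>Pseudo-principality makes each value at points principal, so the definite
    description in \<open>principal_submodel\<close> picks out its generator.\<close>
  have opA: "opn A F xs \<in> X \<and> principal {opn A F xs} = filtermap (\<lambda>f. f xs) (gop U F)"
    if F: "F \<in> fsyms \<Sigma>" and xs: "xs \<in> nlists (?fa F) X" for F xs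
  proof -
    obtain b where b: "b \<in> X" "filtermap (\<lambda>f. f xs) (gop U F) = principal {b}"
      using assms(3) F xs unfolding pseudo_principal_def by blast
    have "opn (e_model \<Sigma> X U) F (map (\<lambda>x. principal {x}) xs) = principal {b}"
      using F xs b(2) ext_op_principal[of "\<lambda>z. z" xs "?fa F" X]
      by (simp add: e_model_def e_op_eq[OF gU(1)])
    then have "opn A F xs = (THE z. z \<in> X \<and> principal {z} = principal {b})"
      using F xs by (simp add: assms(4) principal_submodel_def)
    also have "\<dots> = b" by (rule the_equality) (use b(1) in auto)
    finally show ?thesis using b by simp
  qed
  have relA: "reln A R = limit_rel X (?ra R) (grel U R)" if R: "R \<in> rsyms \<Sigma>" for R
  proof -
    have "map (\<lambda>x. principal {x}) xs \<in> e_rel X (?ra R) (grel U R) \<longleftrightarrow>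
        xs \<in> limit_rel X (?ra R) (grel U R)" if "xs \<in> nlists (?ra R) X" for xs
      using principal_in_tilde_rel[of "\<lambda>z. z" xs "?ra R" X] that by (simp add: e_rel_eq[OF gU(2)[OF R]])
    then show ?thesis
      using R by (auto simp: assms(4) principal_submodel_def e_model_def limit_rel_def)
  qed
  \<comment> \<open>Both operations are iterated limits, and by \<open>opA\<close> their values at
    points coincide.\<close>
  have opU: "tilde_op X (?fa F) (opn A F) = e_op X (?fa F) (gop U F)" if "F \<in> fsyms \<Sigma>" for F
    unfolding e_op_eq[OF gU(1)[OF that]] tilde_op_eq_ext_op
    by (rule ext_op_cong) (use opA[OF that] in blast)
  have tilde: "tilde_model \<Sigma> A = e_model \<Sigma> X U"
    by (auto simp: tilde_model_def e_model_def uA opU relA e_rel_eq[OF gU(2)] intro!: restrict_ext)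
  have star: "star_model \<Sigma> A = E_model \<Sigma> X U"
    by (auto simp: star_model_def E_model_def uA opU relA E_rel_eq[OF gU(2)] intro!: restrict_ext)
  \<comment> \<open>The common condition on tuples from \<open>X\<close>: values at image tuples are
    the evaluation pushforwards from \<open>V\<close>, and relations map into the limit relations of
    \<open>V\<close>.\<close>
  define C where "C \<longleftrightarrow>
    (\<forall>F \<in> fsyms \<Sigma>. \<forall>xs \<in> nlists (?fa F) X.
       principal {h (opn A F xs)} = filtermap (\<lambda>g. g (map h xs)) (gop V F)) \<and>
    (\<forall>R \<in> rsyms \<Sigma>. \<forall>xs \<in> nlists (?ra R) X.
       xs \<in> reln A R \<longrightarrow> map h xs \<in> limit_rel Y (?ra R) (grel V R))"
  have hX: "(\<lambda>x. principal {h x}) \<in> X \<rightarrow> beta Y" "filtermap h \<in> beta X \<rightarrow> beta Y"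
    using h by (auto intro: filtermap_in_beta)
  have limX: "reln A R \<subseteq> nlists (?ra R) X" if "R \<in> rsyms \<Sigma>" for R
    using relA[OF that] by (auto simp: limit_rel_def)
  have limY: "limit_rel Y n r \<subseteq> nlists n Y" for n and r :: "'y list set filter"
    by (auto simp: limit_rel_def)
  have op1: "e_op Y (?fa F) (gop V F) (map (\<lambda>x. principal {h x}) xs) =
      filtermap (\<lambda>g. g (map h xs)) (gop V F)" if "F \<in> fsyms \<Sigma>" "xs \<in> nlists (?fa F) X" for F xs
    unfolding e_op_eq[OF gV(1)[OF that(1)]] by (rule ext_op_principal[OF map_in_nlists[OF that(2) h]])
  have "homomorphism \<Sigma> A (e_model \<Sigma> Y V) (\<lambda>x. principal {h x}) \<longleftrightarrow> C"
    unfolding C_def homomorphism_def using hX(1)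
    by (simp add: uA e_model_def op1 e_rel_eq[OF gV(2)]
        principal_in_tilde_rel[OF map_in_nlists[OF _ h]])
  moreover have "homomorphism \<Sigma> A (E_model \<Sigma> Y V) (\<lambda>x. principal {h x}) \<longleftrightarrow> C"
    unfolding C_def homomorphism_def using hX(1)
    by (simp add: uA E_model_def op1 E_rel_eq[OF gV(2)]
        principal_in_star_rel[OF map_in_nlists[OF _ h]])
  moreover have "homomorphism \<Sigma> (tilde_model \<Sigma> A) (e_model \<Sigma> Y V) (filtermap h) \<longleftrightarrow> C"
    unfolding C_def homomorphism_def using hX(2)
    by (simp add: uA tilde_model_def e_model_def e_op_eq[OF gV(1)] e_rel_eq[OF gV(2)]
        tilde_op_commute_iff[OF h] tilde_rel_preserve_iff[OF h])
  moreover have "homomorphism \<Sigma> (star_model \<Sigma> A) (E_model \<Sigma> Y V) (filtermap h) \<longleftrightarrow> C"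
    unfolding C_def homomorphism_def using hX(2)
    by (simp add: uA star_model_def E_model_def e_op_eq[OF gV(1)] E_rel_eq[OF gV(2)]
        tilde_op_commute_iff[OF h] star_rel_preserve_iff[OF h limX limY])
  \<comment> \<open>Condition (iii) speaks of \<open>e_model \<Sigma> X U\<close>, which equals
    \<open>tilde_model \<Sigma> A\<close>, so it coincides with (iv).\<close>
  ultimately show ?thesis
    by (simp add: Let_def generalized_homomorphism_def tilde star)
qed

end
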